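(* Let $\mathcal F$ be an equidistant foliation of $\mathbb R^{k+n}$ whose leaves are the orbits of a connected Lie group $G\subset\operatorname{Isom}(\mathbb R^{k+n})$ acting effectively on $\mathbb R^{k+n}$, with $F_0=\mathbb R^k\times\{0\}$ being its most singular orbit. Then the induced foliation $\tilde{\mathcal F}=\{F\cap L_p\mid F\in\mathcal F,\ p\in F_0\}$ of $\mathbb R^{k+n}$ is equidistant.
   Context: An equidistant foliation of $\mathbb R^m$ is a partition $\mathcal F$ of $\mathbb R^m$ into complete, smooth, connected, properly embedded submanifolds (leaves, possibly of different dimensions) such that for any two leaves $F,G\in\mathcal F$ and $p\in F$ the distance $\operatorname{dist}(p,G)$ does not depend on the choice of $p\in F$, and such that any vector tangent to a leaf can be locally extended to a smooth vector field everywhere tangent to the leaves. Equidistance of $\tilde{\mathcal F}$ means this distance property for its leaves: for any two leaves $A,B\in\tilde{\mathcal F}$ the number $\operatorname{dist}(x,B)$ does not depend on $x\in A$. Most singular means of smallest dimension. For $p\in F_0$ the horizontal layer through $p$ is the affine space $L_p=p+\nu_pF_0=p+(\{0\}\times\mathbb R^n)$, where $\nu_pF_0$ is the normal space of $F_0$ at $p$. *)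

theory Defs
  imports "HOL-Analysis.Analysis" "HOL-Library.Disjoint_Sets"
begin

section \<open>Smooth maps and submanifolds of Euclidean spaces\<close>

text \<open>The predicate below is meant for open sets only.\<close>

primrec C_diff_on ::
  "nat \<Rightarrow> 'a::euclidean_space set \<Rightarrow> ('a \<Rightarrow> 'b::euclidean_space) \<Rightarrow> bool"
where
  "C_diff_on 0 U f \<longleftrightarrow> continuous_on U f"
| "C_diff_on (Suc r) U f \<longleftrightarrow>
     (\<forall>x\<in>U. f differentiable (at x)) \<and>
     (\<forall>v. C_diff_on r U (\<lambda>x. frechet_derivative f (at x) v))"

definition smooth_map_on ::
  "'a::euclidean_space set \<Rightarrow> ('a \<Rightarrow> 'b::euclidean_space) \<Rightarrow> bool"
where
  "smooth_map_on U f \<longleftrightarrow> open U \<and> (\<forall>r. C_diff_on r U f)"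

definition diffeo_between ::
  "'a::euclidean_space set \<Rightarrow> 'a set \<Rightarrow> ('a \<Rightarrow> 'a) \<Rightarrow> bool"
where
  "diffeo_between U V \<phi> \<longleftrightarrow>
     (\<exists>\<psi>. smooth_map_on U \<phi> \<and> smooth_map_on V \<psi> \<and> \<phi> ` U = V \<and> \<psi> ` V = U \<and>
          (\<forall>x\<in>U. \<psi> (\<phi> x) = x) \<and> (\<forall>y\<in>V. \<phi> (\<psi> y) = y))"

text \<open>Embedded smooth submanifolds without boundary, by slice charts. The model space of a
  chart is a linear subspace of dimension \<open>d\<close> of the ambient space.\<close>

definition embedded_submanifold :: "nat \<Rightarrow> 'a::euclidean_space set \<Rightarrow> bool"
where
  "embedded_submanifold d S \<longleftrightarrow>
     (\<forall>p\<in>S. \<exists>U V \<phi> E. p \<in> U \<and> diffeo_between U V \<phi> \<and>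
        subspace E \<and> dim E = d \<and> \<phi> ` (S \<inter> U) = E \<inter> V)"

definition properly_embedded :: "'a::euclidean_space set \<Rightarrow> bool"
where
  "properly_embedded S \<longleftrightarrow> proper_map (top_of_set S) euclidean (\<lambda>x. x)"

text \<open>Velocities at time 0 of smooth curves in \<open>S\<close> through \<open>p\<close>.\<close>

definition tangent_space :: "'a::euclidean_space set \<Rightarrow> 'a \<Rightarrow> 'a set"
where
  "tangent_space S p =
     {v. \<exists>e>0. \<exists>c::real \<Rightarrow> 'a. smooth_map_on {-e<..<e} c \<and> c ` {-e<..<e} \<subseteq> S \<and>
          c 0 = p \<and> (c has_vector_derivative v) (at 0)}"

definition normal_space :: "'a::euclidean_space set \<Rightarrow> 'a \<Rightarrow> 'a set"
where
  "normal_space S p = (tangent_space S p)\<^sup>\<bottom>"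

text \<open>The Riemannian distance of a submanifold: the infimum of the lengths of piecewise
  \<open>C\<^sup>1\<close> paths inside it. A \<^const>\<open>valid_path\<close> may have an unbounded derivative near
  its finitely many exceptional points, so its length may be infinite; demanding
  \<^const>\<open>has_integral\<close> discards such paths, whereas \<^const>\<open>integral\<close> would assign
  them the length 0.\<close>

definition intrinsic_dist :: "'a::euclidean_space set \<Rightarrow> 'a \<Rightarrow> 'a \<Rightarrow> real"
where
  "intrinsic_dist S x y =
     Inf {l. \<exists>\<gamma>. valid_path \<gamma> \<and> path_image \<gamma> \<subseteq> S \<and>
               pathstart \<gamma> = x \<and> pathfinish \<gamma> = y \<and>
               ((\<lambda>t. norm (vector_derivative \<gamma> (at t))) has_integral l) {0..1}}"

definition complete_submanifold :: "'a::euclidean_space set \<Rightarrow> bool"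
where
  "complete_submanifold S \<longleftrightarrow> Metric_space.mcomplete S (intrinsic_dist S)"

section \<open>Equidistant foliations\<close>

definition equidistant :: "'a::euclidean_space set set \<Rightarrow> bool"
where
  "equidistant \<F> \<longleftrightarrow>
     (\<forall>A\<in>\<F>. \<forall>B\<in>\<F>. \<forall>x\<in>A. \<forall>y\<in>A. infdist x B = infdist y B)"

definition tangent_vectors_extend :: "'a::euclidean_space set set \<Rightarrow> bool"
where
  "tangent_vectors_extend \<F> \<longleftrightarrow>
     (\<forall>F\<in>\<F>. \<forall>p\<in>F. \<forall>v\<in>tangent_space F p.
        \<exists>U X. p \<in> U \<and> smooth_map_on U X \<and> X p = v \<and>
              (\<forall>L\<in>\<F>. \<forall>q\<in>U \<inter> L. X q \<in> tangent_space L q))"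

definition equidistant_foliation :: "'a::euclidean_space set set \<Rightarrow> bool"
where
  "equidistant_foliation \<F> \<longleftrightarrow>
     partition_on UNIV \<F> \<and>
     (\<forall>F\<in>\<F>. (\<exists>d. embedded_submanifold d F) \<and> properly_embedded F \<and>
              connected F \<and> complete_submanifold F) \<and>
     equidistant \<F> \<and>
     tangent_vectors_extend \<F>"

definition most_singular :: "'a::euclidean_space set set \<Rightarrow> 'a set \<Rightarrow> bool"
where
  "most_singular \<F> F0 \<longleftrightarrow>
     F0 \<in> \<F> \<and>
     (\<forall>F\<in>\<F>. \<forall>d0 d. embedded_submanifold d0 F0 \<longrightarrow> embedded_submanifold d F \<longrightarrow> d0 \<le> d)"

definition horizontal_layer :: "'a::euclidean_space set \<Rightarrow> 'a \<Rightarrow> 'a set"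
where
  "horizontal_layer F0 p = (\<lambda>v. p + v) ` normal_space F0 p"

definition induced_foliation ::
  "'a::euclidean_space set set \<Rightarrow> 'a set \<Rightarrow> 'a set set"
where
  "induced_foliation \<F> F0 = {F \<inter> horizontal_layer F0 p |F p. F \<in> \<F> \<and> p \<in> F0}"

section \<open>Lie groups of isometries\<close>

definition Isom :: "('a::metric_space \<Rightarrow> 'a) set"
where
  "Isom = {f. bij f \<and> (\<forall>x y. dist (f x) (f y) = dist x y)}"

text \<open>The isometry \<open>x \<mapsto> A *v x + b\<close> has coordinates \<open>(A, b)\<close>. These identify
  \<^const>\<open>Isom\<close> with an embedded submanifold of a Euclidean space, which is its standard
  structure as a Lie group.\<close>

definition isom_coords :: "(real^'m \<Rightarrow> real^'m) \<Rightarrow> (real^'m^'m) \<times> (real^'m)"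
where
  "isom_coords f = (matrix (\<lambda>x. f x - f 0), f 0)"

text \<open>\<open>G\<close> is a (not necessarily closed) Lie subgroup of \<^const>\<open>Isom\<close>, with \<open>T\<close> its
  manifold topology, possibly finer than the topology induced by \<^const>\<open>Isom\<close>: locally for
  \<open>T\<close>, the inclusion is an embedding onto a submanifold, i.e. \<open>G\<close> is an injectively immersed
  submanifold, and its smooth structure is the one given by these local embeddings.
  In coordinates composition and inversion are restrictions of smooth maps, so with respect
  to this structure they are smooth as soon as they are continuous for \<open>T\<close>.\<close>

definition Lie_subgroup_of_Isom ::
  "(real^'m \<Rightarrow> real^'m) topology \<Rightarrow> (real^'m \<Rightarrow> real^'m) set \<Rightarrow> bool"
where
  "Lie_subgroup_of_Isom T G \<longleftrightarrow>
     G \<subseteq> Isom \<and> id \<in> G \<and> (\<forall>g\<in>G. \<forall>h\<in>G. g \<circ> h \<in> G) \<and> (\<forall>g\<in>G. inv g \<in> G) \<and>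
     topspace T = G \<and> Hausdorff_space T \<and> second_countable T \<and>
     (\<exists>d. \<forall>g\<in>G. \<exists>W. openin T W \<and> g \<in> W \<and>
        embedding_map (subtopology T W) euclidean isom_coords \<and>
        embedded_submanifold d (isom_coords ` W)) \<and>
     continuous_map (prod_topology T T) T (\<lambda>(g, h). g \<circ> h) \<and>
     continuous_map T T inv"

definition acts_effectively :: "('a \<Rightarrow> 'a) set \<Rightarrow> bool"
where
  "acts_effectively G \<longleftrightarrow> (\<forall>g\<in>G. (\<forall>x. g x = x) \<longrightarrow> g = id)"

definition orbit_of :: "('a \<Rightarrow> 'a) set \<Rightarrow> 'a \<Rightarrow> 'a set"
where
  "orbit_of G x = (\<lambda>g. g x) ` G"

section \<open>The coordinate subspace $\mathbf{R}^k \times \{0\}$\<close>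

text \<open>The coordinates of \<open>real^'m\<close> are split into a set \<open>K\<close> of \<open>k\<close> indices and the
  \<open>n\<close> remaining ones, rather than writing \<open>(real^'k) \<times> (real^'n)\<close>, because the latter
  would exclude \<open>k = 0\<close> and \<open>n = 0\<close>.\<close>

definition coord_subspace :: "'m set \<Rightarrow> (real^'m) set"
where
  "coord_subspace K = {x. \<forall>i. i \<notin> K \<longrightarrow> x $ i = 0}"

end

theory Submission
  imports Defs
begin

text \<open>
  Write \<open>V\<close> for the most singular orbit and \<open>g x = A x + g 0\<close> with \<open>A\<close> the
  linear part of \<open>g\<close>. Since \<open>g\<close> preserves \<open>V\<close>, its linear part preserves both \<open>V\<close> and
  \<open>V\<^sup>\<bottom>\<close>. Two points of one slice \<open>F \<inter> L\<^sub>p\<close> are related by some \<open>g\<close> in the stabilizer of \<open>p\<close>,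
  and \<open>g\<close> preserves the slices in \<open>L\<^sub>p\<close>. It need not preserve those in another layer \<open>L\<^sub>q\<close>,
  because it may move \<open>q\<close>. The theorem holds because for such a \<open>g\<close> the translation by
  \<open>q - g q\<close> always maps every orbit into itself: following \<open>g\<close> by this translation gives an isometry
  that fixes \<open>q\<close>, maps each slice in \<open>L\<^sub>q\<close> into itself, and acts on the normal components
  exactly as \<open>g\<close> does. As the squared distance between points of \<open>L\<^sub>p\<close> and \<open>L\<^sub>q\<close> is
  \<open>\<bar>p - q\<bar>\<^sup>2\<close> plus the squared distance of the normal components, the distance from a
  point of \<open>L\<^sub>p\<close> to a slice in \<open>L\<^sub>q\<close> is unchanged by \<open>g\<close> (\<open>infdist_slice_le\<close>).

  So the heart of the matter is: if \<open>L\<close> is the space of all vectors whose multiples are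
  translations along the orbits, then \<open>A x - x \<in> L\<close> for all \<open>g \<in> G\<close> and \<open>x \<in> V\<close>. This is shown
  without Lie algebras. The orbits are closed, so the translations along the orbits form a
  closed subgroup of \<open>\<real>\<^sup>m\<close>, which is discrete transversally to \<open>L\<close>
  (\<open>closed_subgroup_without_line_discrete\<close>). A compactness argument yields a gap
  (\<open>translation_distance_gap\<close>): for some \<open>r > 0\<close>, an element \<open>g\<close> with linear part close to
  the identity never displaces \<open>0\<close> to distance exactly \<open>r\<close> from \<open>L\<close>. The hypothesis on the
  linear part is invariant under conjugation and \<open>G\<close> is transitive on \<open>V\<close>, so the same holds
  for the displacement \<open>g x - x\<close> of every \<open>x \<in> V\<close>. For \<open>g\<close> near the identity this distance
  is less than \<open>r\<close> at \<open>x = 0\<close>, hence, \<open>V\<close> being connected, on all of \<open>V\<close>. But \<open>g x - x\<close> is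
  affine in \<open>x\<close>, and an affine function staying at bounded distance from \<open>L\<close> varies only in
  directions of \<open>L\<close> (\<open>rotates_along_translations_near_id\<close>). The elements with the
  desired property form a subgroup, and a connected group is generated by any neighborhood of the
  identity (\<open>connected_group_generated_near_id\<close>).
\<close>

section \<open>Closed subgroups of a Euclidean space\<close>

lemma int_multiple_in_additive_subgroup:
  fixes S :: "'a::real_vector set"
  assumes "0 \<in> S" and "\<And>x y. x \<in> S \<Longrightarrow> y \<in> S \<Longrightarrow> x + y \<in> S" and "\<And>x. x \<in> S \<Longrightarrow> - x \<in> S"
    and "x \<in> S"
  shows "of_int i *\<^sub>R x \<in> S"
proof (induction i rule: int_induct[where k = 0])
  case base
  then show ?case using assms by simp
next
  case (step1 i)
  then show ?case using assms(2)[of "of_int i *\<^sub>R x" x] assms(4) by (simp add: algebra_simps)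
next
  case (step2 i)
  then show ?case using assms(2)[of "of_int i *\<^sub>R x" "- x"] assms(3,4) by (simp add: algebra_simps)
qed

text \<open>If there were elements \<open>t\<^sub>n \<noteq> 0\<close> tending to \<open>0\<close>, their integer multiples would fill up,
  in the limit, the line in a limit direction of \<open>t\<^sub>n / \<bar>t\<^sub>n\<bar>\<close>.\<close>

lemma closed_subgroup_without_line_discrete:
  fixes S :: "'a::euclidean_space set"
  assumes "closed S"
    and S: "0 \<in> S" "\<And>x y. x \<in> S \<Longrightarrow> y \<in> S \<Longrightarrow> x + y \<in> S" "\<And>x. x \<in> S \<Longrightarrow> - x \<in> S"
    and no_line: "\<And>w. (\<And>s. s *\<^sub>R w \<in> S) \<Longrightarrow> w = 0"
  shows "\<exists>r>0. \<forall>t\<in>S. norm t \<le> r \<longrightarrow> t = 0"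
proof (rule ccontr)
  assume "\<not> ?thesis"
  then have neg: "\<And>r. r > 0 \<Longrightarrow> \<exists>t\<in>S. norm t \<le> r \<and> t \<noteq> 0" by blast
  have "\<exists>t\<in>S. norm t \<le> 1 / real (Suc n) \<and> t \<noteq> 0" for n
    by (rule neg) simp
  then obtain t where t: "\<And>n. t n \<in> S" "\<And>n. norm (t n) \<le> 1 / real (Suc n)" "\<And>n. t n \<noteq> 0"
    by metis
  define u where "u n = t n /\<^sub>R norm (t n)" for n
  have "u n \<in> sphere 0 1" for n using t(3)[of n] by (simp add: u_def)
  then obtain w \<sigma> where w: "w \<in> sphere 0 1" and \<sigma>: "strict_mono (\<sigma> :: nat \<Rightarrow> nat)"
      and lim: "(u \<circ> \<sigma>) \<longlonglongrightarrow> w"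
    using seq_compactE[OF compact_imp_seq_compact[OF compact_sphere[of "0::'a" 1]], of u] by blast
  have t0: "(\<lambda>n. norm (t n)) \<longlonglongrightarrow> 0"
    by (rule tendsto_sandwich[OF _ _ tendsto_const LIMSEQ_inverse_real_of_nat])
       (use t(2) in \<open>auto simp: divide_inverse\<close>)
  have "s *\<^sub>R w \<in> S" for s
  proof -
    \<comment> \<open>the multiple of \<open>norm (t n)\<close> just below \<open>s\<close>, so that \<open>m n *\<^sub>R u n\<close> is an integer multiple of \<open>t n\<close>\<close>
    define m where "m n = of_int \<lfloor>s / norm (t n)\<rfloor> * norm (t n)" for n
    have "\<bar>m n - s\<bar> \<le> norm (t n)" for n
    proof -
      have "norm (t n) > 0" using t(3) by simp
      then have "s = (s / norm (t n)) * norm (t n)" by simp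
      then have "m n - s = (of_int \<lfloor>s / norm (t n)\<rfloor> - s / norm (t n)) * norm (t n)"
        unfolding m_def by (metis left_diff_distrib)
      moreover have "\<bar>of_int \<lfloor>s / norm (t n)\<rfloor> - s / norm (t n)\<bar> \<le> 1" by linarith
      ultimately show ?thesis by (simp add: abs_mult mult_left_le_one_le)
    qed
    then have "(\<lambda>n. m n - s) \<longlonglongrightarrow> 0"
      by (intro Lim_null_comparison[OF eventuallyI t0]) simp
    then have "m \<longlonglongrightarrow> s" using LIM_zero_cancel by blast
    then have "(\<lambda>n. m (\<sigma> n)) \<longlonglongrightarrow> s"
      using LIMSEQ_subseq_LIMSEQ[OF _ \<sigma>, of m s] by (simp add: o_def)
    then have "(\<lambda>n. m (\<sigma> n) *\<^sub>R u (\<sigma> n)) \<longlonglongrightarrow> s *\<^sub>R w"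
      using lim unfolding o_def by (rule tendsto_scaleR)
    moreover have "m n *\<^sub>R u n \<in> S" for n
    proof -
      have "m n *\<^sub>R u n = of_int \<lfloor>s / norm (t n)\<rfloor> *\<^sub>R t n"
        using t(3)[of n] by (simp add: m_def u_def)
      then show ?thesis using int_multiple_in_additive_subgroup[of S "t n"] S t(1) by simp
    qed
    ultimately show ?thesis
      using closed_sequentially[OF \<open>closed S\<close>, of "\<lambda>n. m (\<sigma> n) *\<^sub>R u (\<sigma> n)"] by simp
  qed
  then have "w = 0" by (rule no_line)
  with w show False by simp
qed

section \<open>Distance to a linear subspace\<close>

lemma infdist_add_orthogonal:
  fixes S :: "'a::euclidean_space set"
  assumes "subspace S" "y \<in> S" "\<And>w. w \<in> S \<Longrightarrow> orthogonal z w"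
  shows "infdist (y + z) S = norm z"
proof (rule antisym)
  show "infdist (y + z) S \<le> norm z"
    using infdist_le[OF assms(2), of "y + z"] by (simp add: dist_norm)
  have "norm z \<le> dist (y + z) w" if "w \<in> S" for w
  proof -
    have "orthogonal z (y - w)" using assms that subspace_diff by blast
    then have "(norm (z + (y - w)))\<^sup>2 = (norm z)\<^sup>2 + (norm (y - w))\<^sup>2"
      by (rule norm_add_Pythagorean)
    then have "(norm z)\<^sup>2 \<le> (norm (z + (y - w)))\<^sup>2" by simp
    then show ?thesis by (simp add: dist_norm power2_le_iff_abs_le algebra_simps)
  qed
  moreover have "S \<noteq> {}" using assms by blast
  ultimately show "norm z \<le> infdist (y + z) S"
    unfolding infdist_def by (auto intro!: cINF_greatest)
qed

lemma subspace_orthogonal_decomposition: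
  fixes S :: "'a::euclidean_space set"
  assumes "subspace S"
  obtains y z where "y \<in> S" "\<And>w. w \<in> S \<Longrightarrow> orthogonal z w" "x = y + z"
  using orthogonal_subspace_decomp_exists[of S x] assms span_eq_iff[of S] by metis

text \<open>A line that stays within bounded distance of a subspace is parallel to it.\<close>

lemma line_near_subspace:
  fixes S :: "'a::euclidean_space set"
  assumes S: "subspace S" and bound: "\<And>s. infdist (s *\<^sub>R u + a) S \<le> r"
  shows "u \<in> S"
proof -
  obtain y z where u: "y \<in> S" "\<And>w. w \<in> S \<Longrightarrow> orthogonal z w" "u = y + z"
    using subspace_orthogonal_decomposition[OF S, of u] by metis
  obtain y' z' where a: "y' \<in> S" "\<And>w. w \<in> S \<Longrightarrow> orthogonal z' w" "a = y' + z'"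
    using subspace_orthogonal_decomposition[OF S, of a] by metis
  have le: "norm (s *\<^sub>R z + z') \<le> r" for s
  proof -
    have "infdist ((s *\<^sub>R y + y') + (s *\<^sub>R z + z')) S = norm (s *\<^sub>R z + z')"
      using u a S
      by (intro infdist_add_orthogonal)
         (auto simp: subspace_add subspace_scale orthogonal_clauses)
    with bound[of s] show ?thesis by (simp add: u a algebra_simps)
  qed
  have "z = 0"
  proof (rule ccontr)
    assume "z \<noteq> 0"
    define s where "s = (2 * r + 1) / norm z"
    have "r \<ge> 0" using le[of 0] norm_ge_zero order_trans by blast
    have "norm (s *\<^sub>R z) \<le> norm (s *\<^sub>R z + z') + norm z'"
      by (metis add_diff_cancel_right' norm_triangle_ineq4)
    also have "\<dots> \<le> r + r" using le[of s] le[of 0] by simp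
    finally show False using \<open>z \<noteq> 0\<close> \<open>r \<ge> 0\<close> by (simp add: s_def)
  qed
  with u show ?thesis by simp
qed

section \<open>Isometries with a transitive action on a subspace\<close>

definition linear_part :: "('a::real_vector \<Rightarrow> 'a) \<Rightarrow> 'a \<Rightarrow> 'a"
  where "linear_part g x = g x - g 0"

lemma isometry_linear_part:
  fixes g :: "'a::euclidean_space \<Rightarrow> 'a"
  assumes "g \<in> Isom"
  shows "orthogonal_transformation (linear_part g)"
  using assms by (auto simp: orthogonal_transformation_isometry linear_part_def Isom_def dist_norm)

definition almost_translation :: "real \<Rightarrow> ('a::real_normed_vector \<Rightarrow> 'a) \<Rightarrow> bool"
  where "almost_translation e g \<longleftrightarrow> (\<forall>x. norm (linear_part g x - x) \<le> e * norm x)"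

locale isometry_group_over_subspace =
  fixes G :: "('a::euclidean_space \<Rightarrow> 'a) set" and V :: "'a set"
  assumes isom: "G \<subseteq> Isom" and id_in: "id \<in> G"
    and comp_in: "g \<in> G \<Longrightarrow> h \<in> G \<Longrightarrow> g \<circ> h \<in> G" and inv_in: "g \<in> G \<Longrightarrow> inv g \<in> G"
    and closed_orbits: "closed (orbit_of G x)"
    and subspace_V: "subspace V" and orbit_0: "orbit_of G 0 = V"
begin

lemma inv_app [simp]: "g \<in> G \<Longrightarrow> g (inv g x) = x" "g \<in> G \<Longrightarrow> inv g (g x) = x"
  using isom by (auto simp: Isom_def bij_is_surj surj_f_inv_f bij_is_inj)

lemma orthogonal_linear_part: "g \<in> G \<Longrightarrow> orthogonal_transformation (linear_part g)"
  using isom isometry_linear_part by blast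

lemma linear_linear_part: "g \<in> G \<Longrightarrow> linear (linear_part g)"
  using orthogonal_linear_part orthogonal_transformation_def by blast

lemma norm_linear_part: "g \<in> G \<Longrightarrow> norm (linear_part g x) = norm x"
  using orthogonal_linear_part orthogonal_transformation by blast

lemma linear_part_diff: "g \<in> G \<Longrightarrow> linear_part g (x - y) = g x - g y"
  using linear_diff[OF linear_linear_part, of g x y] by (simp add: linear_part_def)

lemma app_add: "g \<in> G \<Longrightarrow> g (x + y) = g x + linear_part g y"
  using linear_part_diff[of g "x + y" x] by simp

lemma linear_part_comp:
  assumes "g \<in> G" "h \<in> G"
  shows "linear_part (g \<circ> h) x = linear_part g (linear_part h x)"
  using linear_part_diff[OF assms(1), of "h x" "h 0"] by (simp add: linear_part_def)

lemma linear_part_inv [simp]: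
  assumes "g \<in> G"
  shows "linear_part g (linear_part (inv g) x) = x"
    and "linear_part (inv g) (linear_part g x) = x"
  using linear_part_diff[OF assms, of "inv g x" "inv g 0"] linear_part_diff[OF inv_in[OF assms], of "g x" "g 0"]
    assms by (simp_all add: linear_part_def)

subsection \<open>Orbits\<close>

lemma orbit_self: "x \<in> orbit_of G x"
  unfolding orbit_of_def by (rule image_eqI[OF _ id_in]) simp

lemma orbit_app:
  assumes "g \<in> G" "x \<in> orbit_of G y"
  shows "g x \<in> orbit_of G y"
proof -
  obtain h where "h \<in> G" "x = h y" using assms by (auto simp: orbit_of_def)
  then have "g x = (g \<circ> h) y" "g \<circ> h \<in> G" using assms comp_in by simp_all
  then show ?thesis unfolding orbit_of_def by (rule image_eqI)
qed

lemma orbit_trans: "x \<in> orbit_of G y \<Longrightarrow> y \<in> orbit_of G z \<Longrightarrow> x \<in> orbit_of G z"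
  using orbit_app by (auto simp: orbit_of_def[of G y])

lemma orbit_sym: "x \<in> orbit_of G y \<Longrightarrow> y \<in> orbit_of G x"
  unfolding orbit_of_def using inv_in inv_app(2) by (metis (no_types, lifting) imageE imageI)

lemma app_in_V: "g \<in> G \<Longrightarrow> x \<in> V \<Longrightarrow> g x \<in> V"
  using orbit_app orbit_0 by blast

lemma transitive_on_V: "x \<in> V \<Longrightarrow> \<exists>h\<in>G. h 0 = x"
  using orbit_0 unfolding orbit_of_def by blast

lemma linear_part_in_V: "g \<in> G \<Longrightarrow> x \<in> V \<Longrightarrow> linear_part g x \<in> V"
  unfolding linear_part_def using app_in_V subspace_V subspace_0 subspace_diff by blast

lemma linear_part_orthogonal_V:
  assumes "g \<in> G" "v \<in> V\<^sup>\<bottom>"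
  shows "linear_part g v \<in> V\<^sup>\<bottom>"
proof -
  have "orthogonal w (linear_part g v)" if "w \<in> V" for w
  proof -
    have "orthogonal (linear_part (inv g) w) v"
      using assms that linear_part_in_V inv_in by (auto simp: orthogonal_comp_def)
    then have "orthogonal (linear_part g (linear_part (inv g) w)) (linear_part g v)"
      using orthogonal_linear_part[OF assms(1)]
      by (simp add: orthogonal_transformation_def orthogonal_def)
    then show ?thesis using assms by simp
  qed
  then show ?thesis by (simp add: orthogonal_comp_def)
qed

section \<open>Translations along the orbits\<close>

text \<open>Only the orbits are required to be invariant: the translation itself need not belong to \<open>G\<close>.
  In this form the set inherits closedness from the orbits.\<close>

definition orbit_translations :: "'a set"
  where "orbit_translations = {t. \<forall>v. v + t \<in> orbit_of G v}"

text \<open>The identity component of the closed group \<open>orbit_translations\<close>.\<close>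

definition orbit_translation_space :: "'a set"
  where "orbit_translation_space = {t. \<forall>s. s *\<^sub>R t \<in> orbit_translations}"

lemma orbit_translations_0: "0 \<in> orbit_translations"
  by (simp add: orbit_translations_def orbit_self)

lemma orbit_translations_add:
  assumes "s \<in> orbit_translations" "t \<in> orbit_translations"
  shows "s + t \<in> orbit_translations"
  using assms orbit_trans unfolding orbit_translations_def by (force simp flip: add.assoc)

lemma orbit_translations_minus:
  assumes "t \<in> orbit_translations"
  shows "- t \<in> orbit_translations"
proof -
  have "v + - t \<in> orbit_of G v" for v
  proof (rule orbit_sym)
    have "(v + - t) + t \<in> orbit_of G (v + - t)"
      using assms unfolding orbit_translations_def by blast
    then show "v \<in> orbit_of G (v + - t)" by simp
  qed
  then show ?thesis by (simp add: orbit_translations_def)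
qed

text \<open>Conjugating a translation by \<open>g\<close> gives the translation by the rotated vector, and \<open>g\<close>
  preserves the orbits.\<close>

lemma orbit_translations_linear_part:
  assumes "g \<in> G" "t \<in> orbit_translations"
  shows "linear_part g t \<in> orbit_translations"
proof -
  have "v + linear_part g t \<in> orbit_of G v" for v
  proof -
    have "inv g v + t \<in> orbit_of G (inv g v)" using assms by (simp add: orbit_translations_def)
    then have "inv g v + t \<in> orbit_of G v"
      by (rule orbit_trans) (rule orbit_app[OF inv_in[OF assms(1)] orbit_self])
    then have "g (inv g v + t) \<in> orbit_of G v"
      by (rule orbit_app[OF assms(1)])
    then show ?thesis using assms by (simp add: app_add)
  qed
  then show ?thesis by (simp add: orbit_translations_def)
qed

lemma closed_orbit_translations: "closed orbit_translations"
proof -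
  have "orbit_translations = (\<Inter>v. (\<lambda>t. v + t) -` orbit_of G v)"
    by (auto simp: orbit_translations_def)
  moreover have "closed ((\<lambda>t. v + t) -` orbit_of G v)" for v
    by (intro closed_vimage closed_orbits continuous_intros)
  ultimately show ?thesis by auto
qed

lemma orbit_translation_space_subset: "orbit_translation_space \<subseteq> orbit_translations"
  unfolding orbit_translation_space_def by (auto dest: spec[of _ 1])

lemma subspace_orbit_translation_space: "subspace orbit_translation_space"
  unfolding orbit_translation_space_def subspace_def
  by (auto simp: orbit_translations_0 scaleR_add_right orbit_translations_add)

lemma orbit_translation_space_linear_part:
  assumes "g \<in> G" "t \<in> orbit_translation_space"
  shows "linear_part g t \<in> orbit_translation_space"
  using assms orbit_translations_linear_part[OF assms(1)]
  by (auto simp: orbit_translation_space_def simp flip: linear_scale[OF linear_linear_part])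

lemma infdist_linear_part:
  assumes "g \<in> G"
  shows "infdist (linear_part g x) orbit_translation_space = infdist x orbit_translation_space"
proof -
  let ?L = "orbit_translation_space"
  have le: "infdist (linear_part g x) ?L \<le> infdist x ?L" if "g \<in> G" for g x
  proof -
    obtain t where t: "t \<in> ?L" "infdist x ?L = dist x t"
      using infdist_attains_inf[of ?L x] subspace_orbit_translation_space
        closed_subspace subspace_0 by blast
    have "infdist (linear_part g x) ?L \<le> dist (linear_part g x) (linear_part g t)"
      using that t by (intro infdist_le orbit_translation_space_linear_part)
    also have "\<dots> = dist x t"
      using orthogonal_linear_part[OF that] by (simp add: orthogonal_transformation_isometry)
    finally show ?thesis using t by simp
  qed
  show ?thesis
    using le[OF assms, of x] le[OF inv_in[OF assms], of "linear_part g x"] assms by simp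
qed

section \<open>The rotational parts move points along orbit translations\<close>

text \<open>Let \<open>r\<close> be so small that only \<open>0\<close> is a translation along the orbits of length at most \<open>r\<close>
  orthogonal to the translation space. If the claim failed for every \<open>e\<close>, there would be elements
  whose linear parts tend to the identity and whose translational parts have
  components of length \<open>r\<close> orthogonal to that space. These components accumulate at a vector \<open>t\<close> of length
  \<open>r\<close>, and \<open>v + t\<close> lies in the closed orbit of \<open>v\<close> as a limit of its points, a contradiction.\<close>

lemma translation_distance_gap:
  shows "\<exists>r>0. \<exists>e>0. \<forall>g\<in>G. almost_translation e g \<longrightarrow> infdist (g 0) orbit_translation_space \<noteq> r"
proof -
  let ?T = orbit_translations and ?L = orbit_translation_space
  note sub = subspace_orbit_translation_space
  \<comment> \<open>dividing out the lines: this intersection represents the quotient of \<open>?T\<close> by \<open>?L\<close>\<close>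
  define S where "S = ?T \<inter> ?L\<^sup>\<bottom>"
  have sS: "subspace (?L\<^sup>\<bottom>)" by (rule subspace_orthogonal_comp)
  have "\<exists>r>0. \<forall>t\<in>S. norm t \<le> r \<longrightarrow> t = 0"
  proof (rule closed_subgroup_without_line_discrete[of S])
    show "closed S"
      unfolding S_def using closed_orbit_translations closed_subspace[OF sS] by (rule closed_Int)
    show "0 \<in> S" using orbit_translations_0 subspace_0[OF sS] by (simp add: S_def)
    show "x + y \<in> S" if "x \<in> S" "y \<in> S" for x y
      using that orbit_translations_add subspace_add[OF sS] by (simp add: S_def)
    show "- x \<in> S" if "x \<in> S" for x
      using that orbit_translations_minus subspace_neg[OF sS] by (simp add: S_def)
    show "w = 0" if "\<And>s. s *\<^sub>R w \<in> S" for w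
    proof -
      have "w \<in> ?L" using that by (simp add: orbit_translation_space_def S_def)
      moreover have "w \<in> ?L\<^sup>\<bottom>" using that[of 1] by (simp add: S_def)
      ultimately show ?thesis by (auto simp: orthogonal_comp_def orthogonal_self)
    qed
  qed
  then obtain r where r: "r > 0" "\<And>t. t \<in> S \<Longrightarrow> norm t \<le> r \<Longrightarrow> t = 0" by blast
  have "\<exists>e>0. \<forall>g\<in>G. almost_translation e g \<longrightarrow> infdist (g 0) ?L \<noteq> r"
  proof (rule ccontr)
    assume "\<not> ?thesis"
    then have neg: "\<And>e. e > 0 \<Longrightarrow> \<exists>g\<in>G. almost_translation e g \<and> infdist (g 0) ?L = r"
      by blast
    have "\<exists>g\<in>G. almost_translation (1 / real (Suc n)) g \<and> infdist (g 0) ?L = r" for n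
      by (rule neg) simp
    then obtain g where g: "\<And>n. g n \<in> G" "\<And>n. almost_translation (1 / real (Suc n)) (g n)"
        "\<And>n. infdist (g n 0) ?L = r"
      by metis
    have "\<exists>y z. y \<in> ?L \<and> (\<forall>w\<in>?L. orthogonal z w) \<and> g n 0 = y + z" for n
      using subspace_orthogonal_decomposition[OF sub, of "g n 0"] by metis
    then obtain y z where yz: "\<And>n. y n \<in> ?L" "\<And>n w. w \<in> ?L \<Longrightarrow> orthogonal (z n) w"
        "\<And>n. g n 0 = y n + z n"
      by metis
    have nz: "norm (z n) = r" for n
      using g(3)[of n] infdist_add_orthogonal[OF sub yz(1) yz(2), of n n] by (simp add: yz(3))
    then have "z n \<in> sphere 0 r" for n by simp
    then obtain t \<sigma> where t: "t \<in> sphere 0 r" and \<sigma>: "strict_mono (\<sigma> :: nat \<Rightarrow> nat)"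
        and lim: "(z \<circ> \<sigma>) \<longlonglongrightarrow> t"
      using seq_compactE[OF compact_imp_seq_compact[OF compact_sphere[of "0::'a" r]], of z] by blast
    have "t \<in> ?T"
    proof -
      have "v + t \<in> orbit_of G v" for v
      proof -
        have "(\<lambda>n. linear_part (g n) v - v) \<longlonglongrightarrow> 0"
        proof (rule Lim_null_comparison)
          show "\<forall>\<^sub>F n in sequentially. norm (linear_part (g n) v - v) \<le> inverse (real (Suc n)) * norm v"
            using g(2) by (auto simp: almost_translation_def divide_inverse)
          show "(\<lambda>n. inverse (real (Suc n)) * norm v) \<longlonglongrightarrow> 0"
            using tendsto_mult_left_zero[OF LIMSEQ_inverse_real_of_nat] by blast
        qed
        then have "(\<lambda>n. linear_part (g n) v) \<longlonglongrightarrow> v" by (rule LIM_zero_cancel)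
        then have "(\<lambda>n. linear_part (g (\<sigma> n)) v) \<longlonglongrightarrow> v"
          using LIMSEQ_subseq_LIMSEQ[OF _ \<sigma>, of "\<lambda>n. linear_part (g n) v" v] by (simp add: o_def)
        then have "(\<lambda>n. linear_part (g (\<sigma> n)) v + z (\<sigma> n)) \<longlonglongrightarrow> v + t"
          using lim unfolding o_def by (rule tendsto_add)
        moreover have "linear_part (g n) v + z n \<in> orbit_of G v" for n
        proof -
          have "linear_part (g n) v + z n = g n v + - y n"
            using yz(3)[of n] by (simp add: linear_part_def)
          moreover have "- y n \<in> ?T"
            using yz(1) orbit_translation_space_subset orbit_translations_minus by blast
          then have "g n v + - y n \<in> orbit_of G (g n v)" unfolding orbit_translations_def by blast
          ultimately show ?thesis using orbit_trans orbit_app[OF g(1) orbit_self] by metis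
        qed
        ultimately show ?thesis
          using closed_sequentially[OF closed_orbits, of "\<lambda>n. linear_part (g (\<sigma> n)) v + z (\<sigma> n)"]
          by simp
      qed
      then show ?thesis by (simp add: orbit_translations_def)
    qed
    moreover have "t \<in> ?L\<^sup>\<bottom>"
    proof -
      have "z n \<in> ?L\<^sup>\<bottom>" for n using yz(2) by (auto simp: orthogonal_comp_def orthogonal_commute)
      then show ?thesis
        using closed_sequentially[OF closed_subspace[OF sS] _ lim] by simp
    qed
    ultimately have "t = 0" using r(2) t by (simp add: S_def)
    with t r(1) show False by simp
  qed
  with r(1) show ?thesis by blast
qed

lemma almost_translation_conj:
  assumes "g \<in> G" "h \<in> G" "almost_translation e g"
  shows "almost_translation e (h \<circ> g \<circ> inv h)"
proof -
  have "norm (linear_part (h \<circ> g \<circ> inv h) x - x) \<le> e * norm x" for x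
  proof -
    let ?y = "linear_part (inv h) x"
    have "linear_part (h \<circ> g \<circ> inv h) x = linear_part h (linear_part g ?y)"
      using assms by (simp add: linear_part_comp comp_in inv_in)
    then have "linear_part (h \<circ> g \<circ> inv h) x - x = linear_part h (linear_part g ?y - ?y)"
      using assms by (simp add: linear_diff[OF linear_linear_part])
    then have "norm (linear_part (h \<circ> g \<circ> inv h) x - x) = norm (linear_part g ?y - ?y)"
      using assms by (simp add: norm_linear_part)
    also have "\<dots> \<le> e * norm ?y" using assms by (simp add: almost_translation_def)
    finally show ?thesis using assms by (simp add: norm_linear_part inv_in)
  qed
  then show ?thesis by (simp add: almost_translation_def)
qed

definition rotates_along_translations :: "('a \<Rightarrow> 'a) \<Rightarrow> bool"
  where "rotates_along_translations g \<longleftrightarrow>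
    (\<forall>x\<in>V. linear_part g x - x \<in> orbit_translation_space)"

text \<open>Conjugating \<open>g\<close> by an element that moves \<open>x\<close> to \<open>0\<close> turns the displacement of \<open>x\<close> into that of
  \<open>0\<close>. So the gap excludes the distance \<open>r\<close> for the displacement of every \<open>x \<in> V\<close>, and by the
  intermediate value theorem, as the displacement of \<open>0\<close> is shorter than \<open>r\<close>, the
  displacements along a line through \<open>0\<close> all remain at distance at most \<open>r\<close> from the translation space.\<close>

lemma rotates_along_translations_near_id:
  shows "\<exists>r>0. \<exists>e>0. \<forall>g\<in>G. almost_translation e g \<longrightarrow> norm (g 0) < r \<longrightarrow>
    rotates_along_translations g"
proof -
  let ?L = orbit_translation_space
  obtain r e where re: "r > 0" "e > 0"
      "\<And>g. g \<in> G \<Longrightarrow> almost_translation e g \<Longrightarrow> infdist (g 0) ?L \<noteq> r"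
    using translation_distance_gap by blast
  have "rotates_along_translations g"
    if g: "g \<in> G" "almost_translation e g" "norm (g 0) < r" for g
    unfolding rotates_along_translations_def
  proof
    fix x assume x: "x \<in> V"
    have ne: "infdist (g y - y) ?L \<noteq> r" if "y \<in> V" for y
    proof -
      obtain h where h: "h \<in> G" "h 0 = y" using transitive_on_V[OF \<open>y \<in> V\<close>] by blast
      \<comment> \<open>written with a double inverse to have the form of a conjugate by \<open>inv h\<close>\<close>
      let ?g = "inv h \<circ> g \<circ> inv (inv h)"
      have "inv (inv h) = h" using h isom by (auto simp: Isom_def inv_inv_eq)
      then have "?g 0 = linear_part (inv h) (g y - y)"
        using h linear_part_diff[OF inv_in[OF h(1)], of "g y" y] by (simp flip: h(2))
      moreover have "infdist (?g 0) ?L \<noteq> r"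
        by (intro re(3) almost_translation_conj comp_in inv_in g h)
      ultimately show ?thesis using infdist_linear_part[OF inv_in[OF h(1)]] by simp
    qed
    let ?f = "\<lambda>s. infdist (s *\<^sub>R (linear_part g x - x) + g 0) ?L"
    have f: "?f s = infdist (g (s *\<^sub>R x) - s *\<^sub>R x) ?L" for s
    proof -
      have "g (s *\<^sub>R x) = s *\<^sub>R linear_part g x + g 0"
        using linear_scale[OF linear_linear_part[OF g(1)], of s x] by (simp add: linear_part_def algebra_simps)
      then show ?thesis by (simp add: algebra_simps)
    qed
    have neq: "?f s \<noteq> r" for s
      unfolding f using ne subspace_scale[OF subspace_V x] by blast
    have f0: "?f 0 < r"
    proof -
      have "infdist (g 0) ?L \<le> norm (g 0)"
        using infdist_le[OF subspace_0[OF subspace_orbit_translation_space], of "g 0"] by simp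
      with g(3) show ?thesis by simp
    qed
    have "?f s \<le> r" for s
    proof (rule ccontr)
      assume s: "\<not> ?thesis"
      have "connected (range ?f)"
        by (intro connected_continuous_image continuous_intros connected_UNIV)
      then have "r \<in> range ?f"
        by (rule connectedD_interval[OF _ rangeI[of ?f 0] rangeI[of ?f s]]) (use f0 s in auto)
      with neq show False by blast
    qed
    then show "linear_part g x - x \<in> ?L"
      by (rule line_near_subspace[OF subspace_orbit_translation_space])
  qed
  with re show ?thesis by blast
qed

lemma rotates_along_translations_comp:
  assumes "g \<in> G" "h \<in> G" "rotates_along_translations g" "rotates_along_translations h"
  shows "rotates_along_translations (g \<circ> h)"
  unfolding rotates_along_translations_def
proof
  fix x assume x: "x \<in> V"
  have "linear_part (g \<circ> h) x - x = linear_part g (linear_part h x - x) + (linear_part g x - x)"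
    using assms by (simp add: linear_part_comp linear_diff[OF linear_linear_part])
  moreover have "linear_part g (linear_part h x - x) \<in> orbit_translation_space"
    using assms x orbit_translation_space_linear_part by (simp add: rotates_along_translations_def)
  moreover have "linear_part g x - x \<in> orbit_translation_space"
    using assms x by (simp add: rotates_along_translations_def)
  ultimately show "linear_part (g \<circ> h) x - x \<in> orbit_translation_space"
    using subspace_add[OF subspace_orbit_translation_space] by metis
qed

lemma rotates_along_translations_inv:
  assumes "g \<in> G" "rotates_along_translations g"
  shows "rotates_along_translations (inv g)"
  unfolding rotates_along_translations_def
proof
  fix x assume x: "x \<in> V"
  have "linear_part (inv g) (linear_part g x - x) \<in> orbit_translation_space"
    using assms x orbit_translation_space_linear_part inv_in
    by (simp add: rotates_along_translations_def)
  moreover have "linear_part (inv g) (linear_part g x - x) = - (linear_part (inv g) x - x)"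
    using assms by (simp add: linear_diff[OF linear_linear_part] inv_in)
  ultimately show "linear_part (inv g) x - x \<in> orbit_translation_space"
    using subspace_neg[OF subspace_orbit_translation_space] by (metis minus_minus)
qed

section \<open>Slices of orbits orthogonal to the subspace\<close>

text \<open>The map \<open>y \<mapsto> g y - (g q - q)\<close> sends the slice of an orbit through \<open>q\<close> into itself, and preserves
  the distances between the layers of \<open>p\<close> and \<open>q\<close> in the sense that the image of \<open>y\<close> is as
  far from \<open>g (p + v)\<close> as \<open>y\<close> is from \<open>p + v\<close>.\<close>

lemma infdist_slice_le:
  assumes g: "g \<in> G" "rotates_along_translations g"
    and p: "p \<in> V" "g p = p" and q: "q \<in> V" and v: "v \<in> V\<^sup>\<bottom>"
  shows "infdist (g (p + v)) (orbit_of G b \<inter> (+) q ` (V\<^sup>\<bottom>))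
    \<le> infdist (p + v) (orbit_of G b \<inter> (+) q ` (V\<^sup>\<bottom>))"
proof (cases "orbit_of G b \<inter> (+) q ` (V\<^sup>\<bottom>) = {}")
  case True
  then show ?thesis by (simp add: infdist_def)
next
  case False
  let ?B = "orbit_of G b \<inter> (+) q ` (V\<^sup>\<bottom>)"
  have "infdist (g (p + v)) ?B \<le> dist (p + v) y" if y: "y \<in> ?B" for y
  proof -
    obtain w where w: "w \<in> V\<^sup>\<bottom>" "y = q + w" using y by blast
    have "linear_part g (q - p) - (q - p) \<in> orbit_translation_space"
      using g(2) p q subspace_diff[OF subspace_V] by (simp add: rotates_along_translations_def)
    then have "g q - q \<in> orbit_translation_space"
      using linear_part_diff[OF g(1), of q p] p by (simp add: algebra_simps)
    then have "- (g q - q) \<in> orbit_translations"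
      using orbit_translation_space_subset orbit_translations_minus by blast
    then have "g y + - (g q - q) \<in> orbit_of G (g y)" unfolding orbit_translations_def by blast
    moreover have "g y \<in> orbit_of G b" using y orbit_app[OF g(1)] by blast
    ultimately have "g y + - (g q - q) \<in> orbit_of G b" by (rule orbit_trans)
    moreover have "g y + - (g q - q) = q + linear_part g w"
      using w app_add[OF g(1), of q w] by simp
    ultimately have "q + linear_part g w \<in> ?B"
      using linear_part_orthogonal_V[OF g(1) w(1)] by (metis IntI imageI)
    then have "infdist (g (p + v)) ?B \<le> dist (g (p + v)) (q + linear_part g w)"
      by (rule infdist_le)
    also have "\<dots> = norm ((p - q) + linear_part g (v - w))"
      using app_add[OF g(1), of p v] p
      by (simp add: dist_norm linear_diff[OF linear_linear_part[OF g(1)]] add_diff_add)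
    also have "\<dots> = norm ((p - q) + (v - w))"
    proof -
      have vw: "v - w \<in> V\<^sup>\<bottom>" using v w(1) subspace_orthogonal_comp subspace_diff by blast
      have pq: "p - q \<in> V" using p q subspace_V subspace_diff by blast
      have "orthogonal (p - q) (v - w)" "orthogonal (p - q) (linear_part g (v - w))"
        using vw pq linear_part_orthogonal_V[OF g(1) vw] by (auto simp: orthogonal_comp_def)
      then have "(norm ((p - q) + linear_part g (v - w)))\<^sup>2 = (norm ((p - q) + (v - w)))\<^sup>2"
        by (simp add: norm_add_Pythagorean norm_linear_part[OF g(1)])
      then show ?thesis by simp
    qed
    also have "\<dots> = dist (p + v) y" by (simp add: w dist_norm algebra_simps)
    finally show ?thesis .
  qed
  then show ?thesis
    using False by (subst (2) infdist_def) (auto intro!: cINF_greatest)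
qed

lemma equidistant_orthogonal_slices:
  assumes rot: "\<And>g. g \<in> G \<Longrightarrow> rotates_along_translations g"
  shows "equidistant {orbit_of G a \<inter> (+) p ` (V\<^sup>\<bottom>) |a p. p \<in> V}"
proof -
  have le: "infdist y (orbit_of G b \<inter> (+) q ` (V\<^sup>\<bottom>)) \<le> infdist x (orbit_of G b \<inter> (+) q ` (V\<^sup>\<bottom>))"
    if p: "p \<in> V" and q: "q \<in> V"
      and x: "x \<in> orbit_of G a \<inter> (+) p ` (V\<^sup>\<bottom>)" and y: "y \<in> orbit_of G a \<inter> (+) p ` (V\<^sup>\<bottom>)"
    for a b p q x y
  proof -
    have "y \<in> orbit_of G x" using x y orbit_sym orbit_trans by blast
    then obtain g where g: "g \<in> G" "y = g x" by (auto simp: orbit_of_def)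
    obtain v w where v: "v \<in> V\<^sup>\<bottom>" "x = p + v" and w: "w \<in> V\<^sup>\<bottom>" "y = p + w"
      using x y by blast
    \<comment> \<open>this vector lies in \<open>V\<close> and is orthogonal to \<open>V\<close>, so \<open>g\<close> fixes \<open>p\<close>\<close>
    have "g p - p = w - linear_part g v"
      using g v w app_add[OF g(1), of p v] by (simp add: algebra_simps)
    moreover have "w - linear_part g v \<in> V\<^sup>\<bottom>"
      using w v linear_part_orthogonal_V[OF g(1)] subspace_orthogonal_comp subspace_diff by blast
    moreover have "g p - p \<in> V"
      using app_in_V[OF g(1) p] p subspace_V subspace_diff by blast
    ultimately have "orthogonal (g p - p) (g p - p)" unfolding orthogonal_comp_def by auto
    then have "g p = p" by (simp add: orthogonal_self)
    then show ?thesis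
      using infdist_slice_le[OF g(1) rot[OF g(1)] p _ q v(1), of b] g v by simp
  qed
  show ?thesis
    unfolding equidistant_def by (blast intro: antisym le)
qed

end

section \<open>Connected groups of isometries\<close>

text \<open>The translates \<open>h W\<close> are open; they lie inside \<open>H\<close> for \<open>h \<in> H\<close> and outside \<open>H\<close> for \<open>h \<notin> H\<close>, so
  \<open>H\<close> is open and closed.\<close>

lemma connected_group_generated_near_id:
  fixes T :: "('a \<Rightarrow> 'a) topology"
  assumes conn: "connected_space T"
    and cont: "continuous_map (prod_topology T T) T (\<lambda>(g, h). g \<circ> h)"
    and grp: "\<And>g. g \<in> topspace T \<Longrightarrow> bij g" "\<And>g. g \<in> topspace T \<Longrightarrow> inv g \<in> topspace T"
    and W: "openin T W" "id \<in> W" "W \<subseteq> H"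
    and H: "H \<subseteq> topspace T" "\<And>g h. g \<in> H \<Longrightarrow> h \<in> H \<Longrightarrow> g \<circ> h \<in> H" "\<And>g. g \<in> H \<Longrightarrow> inv g \<in> H"
  shows "H = topspace T"
proof -
  define N where "N h = {g \<in> topspace T. inv h \<circ> g \<in> W}" for h
  have N_open: "openin T (N h)" if "h \<in> topspace T" for h
  proof -
    have "continuous_map T (prod_topology T T) (\<lambda>g. (inv h, g))"
      using grp(2)[OF that] by (simp add: continuous_map_pairwise o_def)
    then have "continuous_map T T ((\<lambda>(g, h). g \<circ> h) \<circ> (\<lambda>g. (inv h, g)))"
      using cont by (rule continuous_map_compose)
    then show ?thesis
      unfolding N_def using openin_continuous_map_preimage[OF _ W(1)] by (simp add: o_def)
  qed
  have N_self: "h \<in> N h" if "h \<in> topspace T" for h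
    using that grp(1)[OF that] W(2) by (simp add: N_def bij_is_inj)
  have N_in: "N h \<subseteq> H" if "h \<in> H" for h
  proof
    fix g assume "g \<in> N h"
    then have "h \<circ> (inv h \<circ> g) \<in> H" using that W(3) H(2) by (auto simp: N_def)
    moreover have "h \<circ> (inv h \<circ> g) = g"
      using grp(1)[of h] that H(1) by (auto simp: fun_eq_iff bij_is_surj surj_f_inv_f)
    ultimately show "g \<in> H" by simp
  qed
  have N_out: "N h \<subseteq> topspace T - H" if "h \<in> topspace T - H" for h
  proof
    fix g assume g: "g \<in> N h"
    have "g \<notin> H"
    proof
      assume "g \<in> H"
      then have "(inv h \<circ> g) \<circ> inv g \<in> H" using g W(3) H(2,3) by (auto simp: N_def)
      moreover have "(inv h \<circ> g) \<circ> inv g = inv h"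
        using grp(1)[of g] \<open>g \<in> H\<close> H(1) by (auto simp: fun_eq_iff bij_is_surj surj_f_inv_f)
      ultimately have "inv (inv h) \<in> H" using H(3) by metis
      then show False using that grp(1)[of h] by (simp add: inv_inv_eq)
    qed
    with g show "g \<in> topspace T - H" by (simp add: N_def)
  qed
  have "openin T H"
    using N_open N_self N_in H(1) by (subst openin_subopen) (metis subsetD)
  moreover have "closedin T H"
  proof -
    have "openin T (topspace T - H)"
      using N_open N_self N_out by (subst openin_subopen) (metis DiffD1)
    then show ?thesis using H(1) by (simp add: closedin_def)
  qed
  ultimately have "H = {} \<or> H = topspace T"
    using conn unfolding connected_space_clopen_in by simp
  then show ?thesis using W(2,3) by blast
qed

lemma isom_coords_id: "isom_coords id = (mat 1, 0)"
  by (simp add: isom_coords_def matrix_id_mat_1 flip: id_def)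

text \<open>Relates the coordinates of \<^const>\<open>Isom\<close> to the coordinate-free notion of closeness; the factor is
  the crude bound of the operator norm by the entries of a matrix.\<close>

lemma isom_coords_near_id:
  fixes g :: "real^'m \<Rightarrow> real^'m"
  assumes "g \<in> Isom" "dist (isom_coords g) (isom_coords id) < d"
  shows "almost_translation (real CARD('m) * real CARD('m) * d) g" and "norm (g 0) < d"
proof -
  let ?A = "matrix (linear_part g)"
  have co: "isom_coords g = (?A, g 0)"
    by (simp add: isom_coords_def linear_part_def[abs_def])
  have A: "dist ?A (mat 1) < d"
    using assms(2) dist_fst_le[of "isom_coords g" "isom_coords id"] by (simp add: co isom_coords_id)
  show "norm (g 0) < d"
    using assms(2) dist_snd_le[of "isom_coords g" "isom_coords id"] by (simp add: co isom_coords_id)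
  have lin: "linear (linear_part g)"
    using isometry_linear_part[OF assms(1)] by (simp add: orthogonal_transformation_def)
  have "\<bar>(?A - mat 1) $ i $ j\<bar> \<le> d" for i j
  proof -
    have "\<bar>(?A - mat 1) $ i $ j\<bar> \<le> norm ((?A - mat 1) $ i)" by (rule component_le_norm_cart)
    also have "\<dots> \<le> norm (?A - mat 1)" by (rule Finite_Cartesian_Product.norm_nth_le)
    finally show ?thesis using A by (simp add: dist_norm)
  qed
  then have on: "onorm ((*v) (?A - mat 1)) \<le> real CARD('m) * real CARD('m) * d"
    by (rule onorm_le_matrix_component)
  have "norm (linear_part g x - x) \<le> real CARD('m) * real CARD('m) * d * norm x" for x
  proof -
    have "linear_part g x - x = (?A - mat 1) *v x"
      using matrix_vector_mul(2)[OF lin, THEN fun_cong, of x] by (simp add: matrix_vector_mult_diff_rdistrib)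
    also have "norm \<dots> \<le> onorm ((*v) (?A - mat 1)) * norm x"
      by (rule onorm) (rule matrix_vector_mul_bounded_linear)
    also have "\<dots> \<le> real CARD('m) * real CARD('m) * d * norm x"
      by (rule mult_right_mono[OF on norm_ge_zero])
    finally show ?thesis .
  qed
  then show "almost_translation (real CARD('m) * real CARD('m) * d) g"
    by (simp add: almost_translation_def)
qed

lemma Lie_subgroup_neighborhood_id:
  fixes T :: "(real^'m \<Rightarrow> real^'m) topology"
  assumes Lie: "Lie_subgroup_of_Isom T G" and "d > 0"
  obtains W where "openin T W" "id \<in> W" "\<And>g. g \<in> W \<Longrightarrow> dist (isom_coords g) (isom_coords id) < d"
proof -
  obtain U where U: "openin T U" "id \<in> U" "embedding_map (subtopology T U) euclidean isom_coords"
    using Lie unfolding Lie_subgroup_of_Isom_def by blast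
  have cont: "continuous_map (subtopology T U) euclidean isom_coords"
    using homeomorphic_imp_continuous_map[OF U(3)[unfolded embedding_map_def]]
    by (rule continuous_map_into_fulltopology)
  let ?W = "{g \<in> topspace (subtopology T U). isom_coords g \<in> ball (isom_coords id) d}"
  have "openin (subtopology T U) ?W"
    by (rule openin_continuous_map_preimage[OF cont]) (simp flip: open_openin)
  then have "openin T ?W" using U(1) openin_trans_full by blast
  moreover have "id \<in> ?W" using U \<open>d > 0\<close> openin_subset by auto
  moreover have "dist (isom_coords g) (isom_coords id) < d" if "g \<in> ?W" for g
    using that by (simp add: dist_commute)
  ultimately show ?thesis by (rule that)
qed

section \<open>The normal space of a linear subspace\<close>

lemma C_diff_on_const: "C_diff_on r U (\<lambda>x. c)"
  by (induction r arbitrary: c) (simp_all add: frechet_derivative_const)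

lemma smooth_map_on_line:
  fixes p v :: "'a::euclidean_space"
  assumes "open U"
  shows "smooth_map_on U (\<lambda>s::real. p + s *\<^sub>R v)"
proof -
  have d: "((\<lambda>s::real. p + s *\<^sub>R v) has_derivative (\<lambda>w. w *\<^sub>R v)) (at x)" for x
    by (auto intro!: derivative_eq_intros)
  have "C_diff_on r U (\<lambda>s::real. p + s *\<^sub>R v)" for r
  proof (cases r)
    case 0
    then show ?thesis by (auto intro!: continuous_intros)
  next
    case (Suc n)
    have "frechet_derivative (\<lambda>s::real. p + s *\<^sub>R v) (at x) = (\<lambda>w. w *\<^sub>R v)" for x
      using frechet_derivative_at[OF d] by simp
    then show ?thesis
      using d unfolding Suc by (auto simp: C_diff_on_const differentiable_def)
  qed
  with assms show ?thesis by (simp add: smooth_map_on_def)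
qed

text \<open>Straight lines realize every direction of \<open>V\<close>. Conversely, the scalar product of a curve in \<open>V\<close> with
  a vector orthogonal to \<open>V\<close> vanishes, and so does its derivative.\<close>

lemma tangent_space_subspace:
  fixes V :: "'a::euclidean_space set"
  assumes V: "subspace V" and p: "p \<in> V"
  shows "tangent_space V p = V"
proof
  show "V \<subseteq> tangent_space V p"
  proof
    fix v assume v: "v \<in> V"
    let ?c = "\<lambda>s::real. p + s *\<^sub>R v"
    have "smooth_map_on {-1<..<1} ?c" by (rule smooth_map_on_line) simp
    moreover have "?c ` {-1<..<1} \<subseteq> V" using V p v by (auto simp: subspace_add subspace_scale)
    moreover have "(?c has_vector_derivative v) (at 0)"
      by (auto intro!: derivative_eq_intros)
    ultimately show "v \<in> tangent_space V p"
      unfolding tangent_space_def by (auto intro!: exI[of _ "1::real"] exI[of _ ?c])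
  qed
  show "tangent_space V p \<subseteq> V"
  proof
    fix v assume "v \<in> tangent_space V p"
    then obtain e :: real and c where c: "e > 0" "c ` {-e<..<e} \<subseteq> V"
        "(c has_vector_derivative v) (at 0)"
      unfolding tangent_space_def by blast
    have "orthogonal w v" if w: "w \<in> V\<^sup>\<bottom>" for w
    proof -
      have "((\<lambda>s. w \<bullet> c s) has_vector_derivative w \<bullet> v) (at 0)"
        using bounded_linear.has_vector_derivative[OF bounded_linear_inner_right c(3)] .
      moreover have "w \<bullet> c s = 0" if "s \<in> {-e<..<e}" for s
      proof -
        have "c s \<in> V" using c(2) that by blast
        then show ?thesis
          using w by (simp add: orthogonal_comp_def orthogonal_def inner_commute[of w])
      qed
      ultimately have "((\<lambda>s. 0) has_vector_derivative w \<bullet> v) (at 0)"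
        using has_vector_derivative_transform_within_open[of "\<lambda>s. w \<bullet> c s" "w \<bullet> v" 0 "{-e<..<e}" "\<lambda>s. 0"] c(1)
        by simp
      then have "w \<bullet> v = 0"
        using vector_derivative_unique_at has_vector_derivative_const by blast
      then show ?thesis by (simp add: orthogonal_def)
    qed
    then have "v \<in> V\<^sup>\<bottom>\<^sup>\<bottom>" by (simp add: orthogonal_comp_def)
    then show "v \<in> V" using orthogonal_comp_self[OF V] by simp
  qed
qed

lemma horizontal_layer_subspace:
  assumes "subspace V" "p \<in> V"
  shows "horizontal_layer V p = (+) p ` (V\<^sup>\<bottom>)"
  unfolding horizontal_layer_def normal_space_def tangent_space_subspace[OF assms] ..

lemma properly_embedded_imp_closed:
  assumes "properly_embedded S"
  shows "closed S"
proof -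
  have "closed_map (top_of_set S) euclidean (\<lambda>x. x)"
    using assms unfolding properly_embedded_def by (rule proper_imp_closed_map)
  then have "closedin euclidean ((\<lambda>x. x) ` S)"
    unfolding closed_map_def by (metis closedin_topspace topspace_euclidean_subtopology)
  then show ?thesis by simp
qed

lemma subspace_coord_subspace: "subspace (coord_subspace K)"
  by (auto simp: coord_subspace_def subspace_def)

section \<open>The induced foliation\<close>

theorem theorem3p6:
  fixes k n :: nat
    and K :: "'m::finite set"
    and \<F> :: "(real^'m) set set"
    and F\<^sub>0 :: "(real^'m) set"
    and G :: "(real^'m \<Rightarrow> real^'m) set"
    and T :: "(real^'m \<Rightarrow> real^'m) topology"
  assumes "CARD('m) = k + n" and "card K = k"
    and "equidistant_foliation \<F>"
    and "Lie_subgroup_of_Isom T G" and "connected_space T"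
    and "acts_effectively G"
    and "\<F> = range (orbit_of G)"
    and "F\<^sub>0 = coord_subspace K"
    and "most_singular \<F> F\<^sub>0"
  shows "equidistant (induced_foliation \<F> F\<^sub>0)"
proof -
  have sub: "subspace F\<^sub>0" using assms(8) subspace_coord_subspace by simp
  have Lie: "G \<subseteq> Isom" "id \<in> G" "\<And>g h. g \<in> G \<Longrightarrow> h \<in> G \<Longrightarrow> g \<circ> h \<in> G"
      "\<And>g. g \<in> G \<Longrightarrow> inv g \<in> G" "topspace T = G"
      "continuous_map (prod_topology T T) T (\<lambda>(g, h). g \<circ> h)"
    using assms(4) by (auto simp: Lie_subgroup_of_Isom_def)
  have orbits: "partition_on UNIV \<F>" "\<And>x. orbit_of G x \<in> \<F>"
    using assms(3,7) by (auto simp: equidistant_foliation_def)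
  have "F\<^sub>0 = orbit_of G 0"
  proof -
    have "0 \<in> F\<^sub>0" using sub by (rule subspace_0)
    moreover have "0 \<in> orbit_of G 0"
      unfolding orbit_of_def by (rule image_eqI[OF _ Lie(2)]) simp
    moreover have "F\<^sub>0 \<in> \<F>" using assms(9) by (simp add: most_singular_def)
    ultimately show ?thesis
      using partition_onD2[OF orbits(1)] orbits(2) unfolding disjoint_def by blast
  qed
  moreover have "closed (orbit_of G x)" for x
    using assms(3) orbits(2) properly_embedded_imp_closed unfolding equidistant_foliation_def
    by blast
  ultimately interpret isometry_group_over_subspace G F\<^sub>0
    using Lie sub by unfold_locales auto
  obtain r e where re: "r > 0" "e > 0" "\<And>g. g \<in> G \<Longrightarrow> almost_translation e g \<Longrightarrow>
      norm (g 0) < r \<Longrightarrow> rotates_along_translations g"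
    using rotates_along_translations_near_id by blast
  define N where "N = real CARD('m) * real CARD('m)"
  have "N > 0" by (simp add: N_def)
  define d where "d = min r (e / N)"
  have d: "d > 0" "d \<le> r" "N * d \<le> e"
    using re(1,2) \<open>N > 0\<close> by (auto simp: d_def min_def field_simps)
  obtain W where W: "openin T W" "id \<in> W" "\<And>g. g \<in> W \<Longrightarrow> dist (isom_coords g) (isom_coords id) < d"
    using Lie_subgroup_neighborhood_id[OF assms(4) d(1)] by metis
  have "rotates_along_translations g" if "g \<in> W" for g
  proof (rule re(3))
    show "g \<in> G" using that openin_subset[OF W(1)] Lie(5) by blast
    then have "g \<in> Isom" using Lie(1) by blast
    note near = isom_coords_near_id[OF this W(3)[OF that]]
    have "norm (linear_part g x - x) \<le> e * norm x" for x
    proof -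
      have "norm (linear_part g x - x) \<le> N * d * norm x"
        using near(1) by (simp add: almost_translation_def N_def)
      also have "\<dots> \<le> e * norm x" using d(3) by (rule mult_right_mono) simp
      finally show ?thesis .
    qed
    then show "almost_translation e g" by (simp add: almost_translation_def)
    show "norm (g 0) < r" using near(2) d(2) by simp
  qed
  then have W_sub: "W \<subseteq> {g \<in> G. rotates_along_translations g}"
    using openin_subset[OF W(1)] Lie(5) by blast
  have "{g \<in> G. rotates_along_translations g} = topspace T"
    using rotates_along_translations_comp rotates_along_translations_inv Lie
    by (intro connected_group_generated_near_id[OF assms(5) Lie(6) _ _ W(1,2) W_sub])
       (auto simp: Isom_def)
  then have "\<And>g. g \<in> G \<Longrightarrow> rotates_along_translations g" using Lie(5) by blast
  then have "equidistant {orbit_of G a \<inter> (+) p ` (F\<^sub>0\<^sup>\<bottom>) |a p. p \<in> F\<^sub>0}"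
    by (rule equidistant_orthogonal_slices)
  moreover have "induced_foliation \<F> F\<^sub>0 = {orbit_of G a \<inter> (+) p ` (F\<^sub>0\<^sup>\<bottom>) |a p. p \<in> F\<^sub>0}"
    unfolding induced_foliation_def assms(7)
    using horizontal_layer_subspace[OF sub] by (safe; metis rangeI)
  ultimately show ?thesis by simp
qed

end
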